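(* For $|q|<1$, $$\sum_{m,k\geq0}\frac{q^{k^2+(m+k)^2}}{(q)_m(q)_{2k}}(-q;q^2)_k=\frac{(q^{20},q^{10},q^{10};q^{20})_\infty}{(q)_\infty}.$$
   Context: For $m$ a nonnegative integer, $(a;q)_m=\prod_{j=0}^{m-1}(1-aq^j)$ (with $(a;q)_0=1$), $(a;q)_\infty=\prod_{j\ge0}(1-aq^j)$, and $(a_1,\ldots,a_r;q)_\infty=(a_1;q)_\infty\cdots(a_r;q)_\infty$. In particular $(q)_m=(q;q)_m=\prod_{j=1}^m(1-q^j)$, $(q)_\infty=(q;q)_\infty$, and $(-q;q^2)_m=\prod_{j=0}^{m-1}(1+q^{2j+1})$. *)

theory Defs
  imports "HOL-Analysis.Analysis"
begin

definition qpoch :: "complex \<Rightarrow> complex \<Rightarrow> nat \<Rightarrow> complex"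
  where "qpoch a q m = (\<Prod>j<m. 1 - a * q ^ j)"

definition qpoch_inf :: "complex \<Rightarrow> complex \<Rightarrow> complex"
  where "qpoch_inf a q = (\<Prod>j. 1 - a * q ^ j)"

definition qpoch_inf_list :: "complex list \<Rightarrow> complex \<Rightarrow> complex"
  where "qpoch_inf_list as q = (\<Prod>a\<leftarrow>as. qpoch_inf a q)"

(* The infinite product converges in the sense of the library (finitely many vanishing
   factors are allowed), so that qpoch_inf is meaningful for |q| < 1. *)
lemma convergent_prod_qpoch:
  fixes a q :: complex
  assumes "norm q < 1"
  shows "convergent_prod (\<lambda>j. 1 - a * q ^ j)"
proof -
  have "summable (\<lambda>j. norm a * norm q ^ j)"
    using assms by (intro summable_mult summable_geometric) simp
  then have "summable (\<lambda>j. norm ((1 - a * q ^ j) - 1))"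
    by (simp add: norm_mult norm_power)
  then have "abs_convergent_prod (\<lambda>j. 1 - a * q ^ j)"
    by (rule summable_imp_abs_convergent_prod)
  then show ?thesis
    by (rule abs_convergent_prod_imp_convergent_prod)
qed

end

(* Write v(k) = 1 / (q;q)_k, with v(k) = 0 for k < 0. The finite Jacobi triple product at x = i with
   base y, where y^2 = q, says that beta_n = (-q;q^2)_n / (q;q)_(2n) forms a Bailey pair relative
   to a = 1 with alpha_t = i^t y^(t^2):  beta_n = sum_t alpha_t v(n-t) v(n+t).
   Two applications of Bailey's lemma (each a q-Vandermonde summation, the second in the limit
   n -> infinity) turn the double sum into  (sum_t alpha_t q^(2 t^2)) / (q;q)_inf
   = (sum_t i^t (y^5)^(t^2)) / (q;q)_inf.  The limit of the same finite triple product, now with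
   base y^5, evaluates the theta series as (z;z)_inf (-z;z^2)_inf with z = q^5, which equals
   (z^4;z^4)_inf (z^2;z^4)_inf^2. *)
theory Submission
  imports Defs
begin

section \<open>q-Pochhammer symbols and their reciprocals\<close>

lemma qpoch_nonzero:
  assumes "norm q < 1"
  shows "qpoch q q m \<noteq> 0"
proof -
  have "q * q ^ j \<noteq> 1" for j
  proof
    assume "q * q ^ j = 1"
    then have "norm q ^ Suc j = 1" by (metis norm_one norm_power power_Suc)
    then show False using assms by (metis nat.distinct(1) norm_ge_zero order_less_irrefl power_eq_imp_eq_base power_one zero_le_one zero_less_Suc)
  qed
  then show ?thesis by (auto simp: qpoch_def)
qed

lemma qpoch_tendsto:
  assumes "norm q < 1"
  shows "qpoch a q \<longlonglongrightarrow> qpoch_inf a q"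
  using convergent_prod_LIMSEQ[OF convergent_prod_qpoch[OF assms, of a]]
  unfolding qpoch_def [abs_def] qpoch_inf_def
  \<comment> \<open>The library's partial products include the index \<open>n\<close>, whereas
    \<open>qpoch\<close> stops at \<open>n - 1\<close>.\<close>
  by (simp add: LIMSEQ_lessThan_iff_atMost[of "\<lambda>A. prod (\<lambda>j. 1 - a * q ^ j) A"])

lemma qpoch_inf_nonzero:
  assumes "norm q < 1"
  shows "qpoch_inf q q \<noteq> 0"
  unfolding qpoch_inf_def
proof (rule prodinf_nonzero[OF convergent_prod_qpoch[OF assms]])
  show "1 - q * q ^ i \<noteq> 0" for i
    using qpoch_nonzero[OF assms, of "Suc i"] by (auto simp: qpoch_def)
qed

text \<open>
  The integer index, with the value \<open>0\<close> at negative indices, makes \<open>inv_qpoch_rec\<close> and the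
  q-Pascal rule hold without side conditions, so boundary terms of shifted sums vanish.
\<close>
definition inv_qpoch :: "complex \<Rightarrow> int \<Rightarrow> complex"
  where "inv_qpoch q k = (if k < 0 then 0 else inverse (qpoch q q (nat k)))"

lemma inv_qpoch_neg [simp]: "k < 0 \<Longrightarrow> inv_qpoch q k = 0"
  by (simp add: inv_qpoch_def)

lemma inv_qpoch_of_nat [simp]: "inv_qpoch q (int k) = inverse (qpoch q q k)"
  by (simp add: inv_qpoch_def)

lemma inv_qpoch_0 [simp]: "inv_qpoch q 0 = 1"
  by (simp add: inv_qpoch_def qpoch_def)

lemma inv_qpoch_rec:
  assumes "norm q < 1"
  shows "inv_qpoch q k * (1 - q powi k) = inv_qpoch q (k - 1)"
proof (cases "k \<le> 0")
  \<comment> \<open>At \<open>k = 0\<close> the factor \<open>1 - q powi 0\<close> is zero and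
    matches the default value at \<open>-1\<close>; for \<open>k < 0\<close> both sides are default
    values.\<close>
  case True
  then show ?thesis by (cases "k = 0") auto
next
  case False
  then obtain m where m: "k = int (Suc m)"
    by (metis linorder_not_le zero_less_imp_eq_int Suc_pred)
  have "qpoch q q (Suc m) = qpoch q q m * (1 - q ^ Suc m)"
    by (simp add: qpoch_def)
  moreover have "1 - q ^ Suc m \<noteq> 0"
    using qpoch_nonzero[OF assms, of "Suc m"] calculation by (metis mult_zero_right)
  moreover have "k - 1 = int m" using m by simp
  ultimately show ?thesis
    by (simp only: m power_int_of_nat inv_qpoch_of_nat) (simp del: power_Suc)
qed

text \<open>The fixed shift \<open>c\<close> covers the factors with index n - t, n + t and n - k
  met below; the default value occurs only for n < |c|, so the limit does not see it.\<close>

lemma inv_qpoch_tendsto: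
  assumes "norm q < 1"
  shows "(\<lambda>n. inv_qpoch q (int n + c)) \<longlonglongrightarrow> inverse (qpoch_inf q q)"
proof -
  have "(\<lambda>n. inverse (qpoch q q n)) \<longlonglongrightarrow> inverse (qpoch_inf q q)"
    by (intro tendsto_inverse qpoch_tendsto qpoch_inf_nonzero assms)
  moreover have "filterlim (\<lambda>n. nat (int n + c)) sequentially sequentially"
  proof (rule filterlim_at_top_mono[OF filterlim_minus_const_nat_at_top[of "nat \<bar>c\<bar>"]])
  qed (auto intro!: eventuallyI)
  ultimately have *: "(\<lambda>n. inverse (qpoch q q (nat (int n + c)))) \<longlonglongrightarrow> inverse (qpoch_inf q q)"
    by (rule filterlim_compose)
  show ?thesis
  proof (rule Lim_transform_eventually[OF *])
    show "\<forall>\<^sub>F n in sequentially.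
            inverse (qpoch q q (nat (int n + c))) = inv_qpoch q (int n + c)"
      using eventually_ge_at_top[of "nat \<bar>c\<bar>"]
      by eventually_elim (auto simp: inv_qpoch_def)
  qed
qed

text \<open>A convergent sequence is bounded; this \<open>C\<close> enters every dominating series
  below.\<close>

lemma inv_qpoch_bounded:
  assumes "norm q < 1"
  obtains C where "C > 0" "\<And>k. norm (inv_qpoch q k) \<le> C"
proof -
  have "Bseq (\<lambda>n. inv_qpoch q (int n + 0))"
    using inv_qpoch_tendsto[OF assms] by (rule convergent_imp_Bseq[OF convergentI])
  then obtain C where C: "C > 0" "\<And>n. norm (inv_qpoch q (int n)) \<le> C"
    by (auto simp: Bseq_def)
  have "norm (inv_qpoch q k) \<le> C" for k
    using C(1) C(2)[of "nat k"] by (cases "k < 0") auto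
  with C(1) show ?thesis by (rule that)
qed

section \<open>The finite Jacobi triple product\<close>

text \<open>Write 1 - q^(k+l) = (1 - q^l) + q^l (1 - q^k); each bracket lowers one index by
  \<open>inv_qpoch_rec\<close>.\<close>

lemma q_pascal:
  assumes "norm q < 1" and "q \<noteq> 0"
  shows "inv_qpoch q k * inv_qpoch q l * (1 - q powi (k + l)) =
           inv_qpoch q k * inv_qpoch q (l - 1) + q powi l * (inv_qpoch q (k - 1) * inv_qpoch q l)"
  using assms(2)
  by (simp add: inv_qpoch_rec[OF assms(1), symmetric] power_int_add algebra_simps)

text \<open>Induction on \<open>a\<close> with \<open>b = 0\<close>, then on \<open>b\<close>: the
  q-Pascal rule turns each new linear factor into a step of the bilateral sum.\<close>

lemma finite_jacobi_triple:
  fixes q x :: complex and a b :: nat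
  assumes q: "norm q < 1" "q \<noteq> 0" and x: "x \<noteq> 0"
  shows "(\<Prod>j<a. 1 + x * q ^ (2 * j + 1)) * (\<Prod>j<b. 1 + q ^ (2 * j + 1) / x) =
           qpoch (q\<^sup>2) (q\<^sup>2) (a + b) * (\<Sum>t = -int b..int a. x powi t * q powi (t\<^sup>2) *
             (inv_qpoch (q\<^sup>2) (int a - t) * inv_qpoch (q\<^sup>2) (int b + t)))"
proof -
  have q2: "norm (q\<^sup>2) < 1" "q\<^sup>2 \<noteq> 0"
    using q by (auto simp: norm_power power_less_one_iff abs_square_less_1)
  let ?v = "inv_qpoch (q\<^sup>2)"
  define S where "S = (\<lambda>x a b. \<Sum>t = -int b..int a. x powi t * q powi (t\<^sup>2) * (?v (int a - t) * ?v (int b + t)))"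
  \<comment> \<open>q-Pascal with indices b + t and a + 1 - t splits the sum in two. One half is
    \<open>S x a b\<close>; the other becomes x q^(2a+1) times \<open>S x a b\<close> after shifting
    \<open>t\<close> by one, because t^2 + 2(a + 1 - t) = (t - 1)^2 + 2a + 1.\<close>
  have step_a: "(1 - (q\<^sup>2) powi (int a + int b + 1)) * S x (Suc a) b = (1 + x * q ^ (2 * a + 1)) * S x a b"
    if x: "x \<noteq> 0" for x a b
  proof -
    have "(1 - (q\<^sup>2) powi (int a + int b + 1)) * S x (Suc a) b =
      (\<Sum>t = -int b..int a + 1. x powi t * q powi (t\<^sup>2) * (?v (int b + t) * ?v (int a - t)))
      + (\<Sum>t = -int b..int a + 1. x powi t * q powi (t\<^sup>2) *
          ((q\<^sup>2) powi (int a + 1 - t) * (?v (int b + t - 1) * ?v (int a + 1 - t))))"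
      unfolding S_def sum_distrib_left sum.distrib[symmetric]
    proof (intro sum.cong)
      fix t
      have *: "int b + t + (int a + 1 - t) = int a + int b + 1"
        by simp
      show "(1 - (q\<^sup>2) powi (int a + int b + 1)) *
         (x powi t * q powi t\<^sup>2 * (?v (int (Suc a) - t) * ?v (int b + t))) =
         x powi t * q powi t\<^sup>2 * (?v (int b + t) * ?v (int a - t)) +
         x powi t * q powi t\<^sup>2 * ((q\<^sup>2) powi (int a + 1 - t) * (?v (int b + t - 1) * ?v (int a + 1 - t)))"
        using arg_cong[where f = "\<lambda>y. x powi t * q powi t\<^sup>2 * y",
            OF q_pascal[OF q2, of "int b + t" "int a + 1 - t"]]
        unfolding * by (simp add: ring_distribs mult_ac add_ac)
    qed (simp add: add.commute)
    \<comment> \<open>The extra term t = a + 1 contains \<open>?v\<close> at -1, hence is zero; in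
      the other half the same happens at t = -b.\<close>
    also have "(\<Sum>t = -int b..int a + 1. x powi t * q powi (t\<^sup>2) * (?v (int b + t) * ?v (int a - t))) = S x a b"
      unfolding S_def by (rule sum.mono_neutral_cong_right) auto
    also have "(\<Sum>t = -int b..int a + 1. x powi t * q powi (t\<^sup>2) *
          ((q\<^sup>2) powi (int a + 1 - t) * (?v (int b + t - 1) * ?v (int a + 1 - t)))) =
        (\<Sum>t = -int b+1..int a + 1. x powi t * q powi (t\<^sup>2) *
          ((q\<^sup>2) powi (int a + 1 - t) * (?v (int b + t - 1) * ?v (int a + 1 - t))))"
      by (rule sum.mono_neutral_right) auto
    also have "\<dots> = (\<Sum>t = -int b..int a. x * q ^ (2 * a + 1) * (x powi t * q powi (t\<^sup>2) * (?v (int a - t) * ?v (int b + t))))"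
    proof (rule sum.reindex_bij_witness[of _ "\<lambda>t. t + 1" "\<lambda>t. t - 1"], goal_cases)
      case (5 t)
      have "q powi (t\<^sup>2) * (q\<^sup>2) powi (int a + 1 - t) = q powi (t\<^sup>2 + 2 * (int a + 1 - t))"
        unfolding power_int_add[OF disjI1[OF q(2)]] power_int_mult by simp
      also have "t\<^sup>2 + 2 * (int a + 1 - t) = (t - 1)\<^sup>2 + int (2 * a + 1)"
        by (simp add: power2_eq_square algebra_simps)
      also have "q powi \<dots> = q powi ((t - 1)\<^sup>2) * q ^ (2 * a + 1)"
        unfolding power_int_add[OF disjI1[OF q(2)]] power_int_of_nat ..
      finally have Q: "q powi (t\<^sup>2) * (q\<^sup>2) powi (int a + 1 - t) = q powi ((t - 1)\<^sup>2) * q ^ (2 * a + 1)" .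
      have X: "x powi t = x powi (t - 1) * x"
        using x power_int_add_1[of x "t - 1"] by simp
      have V: "int a - (t - 1) = int a + 1 - t" "int b + (t - 1) = int b + t - 1" by auto
      have "x powi t * q powi (t\<^sup>2) * ((q\<^sup>2) powi (int a + 1 - t) * (?v (int b + t - 1) * ?v (int a + 1 - t)))
        = x powi t * (q powi (t\<^sup>2) * (q\<^sup>2) powi (int a + 1 - t)) * (?v (int b + t - 1) * ?v (int a + 1 - t))"
        by (simp only: mult_ac)
      then show ?case unfolding Q X V by (simp only: mult_ac)
    qed auto
    also have "\<dots> = x * q ^ (2 * a + 1) * S x a b"
      unfolding S_def by (rule sum_distrib_left [symmetric])
    finally show ?thesis
      by (simp only: ring_distribs mult_1)
  qed
  \<comment> \<open>The exponent t^2 is even, so reversing \<open>t\<close> exchanges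
    \<open>a\<close> with \<open>b\<close> and \<open>x\<close> with \<open>1 / x\<close>. The
    induction on \<open>b\<close> can thus reuse \<open>step_a\<close>.\<close>
  have sym: "S x b a = S (1 / x) a b" for x a b
    unfolding S_def
    by (rule sum.reindex_bij_witness[of _ "uminus" "uminus"])
       (auto simp: power_int_minus power_int_divide_distrib inverse_eq_divide algebra_simps)
  have step_qpoch: "qpoch (q\<^sup>2) (q\<^sup>2) (Suc n) = qpoch (q\<^sup>2) (q\<^sup>2) n * (1 - (q\<^sup>2) powi (int n + 1))" for n
    by (simp add: qpoch_def power_int_add_1' q2)
  have a0: "(\<Prod>j<a. 1 + x * q ^ (2 * j + 1)) = qpoch (q\<^sup>2) (q\<^sup>2) a * S x a 0" if "x \<noteq> 0" for x a
  proof (induction a)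
    case 0
    show ?case by (simp add: S_def qpoch_def)
  next
    case (Suc a)
    then show ?case
      using step_a[OF that, of a 0] by (simp add: step_qpoch mult_ac del: power_Suc)
  qed
  have "(\<Prod>j<a. 1 + x * q ^ (2 * j + 1)) * (\<Prod>j<b. 1 + q ^ (2 * j + 1) / x)
          = qpoch (q\<^sup>2) (q\<^sup>2) (a + b) * S x a b"
  proof (induction b)
    case 0
    show ?case using a0[OF x] by simp
  next
    case (Suc b)
    have E: "(1 - (q\<^sup>2) powi (int b + int a + 1)) * S x a (Suc b) = (1 + 1 / x * q ^ (2 * b + 1)) * S x a b"
      unfolding sym[of x a "Suc b"] sym[of x a b] using step_a[of "1 / x" b a] x by simp
    have "(\<Prod>j<a. 1 + x * q ^ (2 * j + 1)) * (\<Prod>j<Suc b. 1 + q ^ (2 * j + 1) / x) =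
        (1 + 1 / x * q ^ (2 * b + 1)) *
        ((\<Prod>j<a. 1 + x * q ^ (2 * j + 1)) * (\<Prod>j<b. 1 + q ^ (2 * j + 1) / x))"
      by (simp add: mult_ac)
    also have "\<dots> = qpoch (q\<^sup>2) (q\<^sup>2) (a + b) * ((1 + 1 / x * q ^ (2 * b + 1)) * S x a b)"
      unfolding Suc by (simp only: mult_ac)
    also have "\<dots> = qpoch (q\<^sup>2) (q\<^sup>2) (a + Suc b) * S x a (Suc b)"
      unfolding E [symmetric] by (simp add: step_qpoch mult_ac add_ac)
    finally show ?case .
  qed
  then show ?thesis by (simp add: S_def)
qed


section \<open>q-Vandermonde summation and the Bailey kernel\<close>

text \<open>This is the q-Vandermonde sum with one upper parameter sent to infinity. Both sides
  satisfy the same recurrence, which lowers \<open>n\<close> and raises \<open>c\<close>.\<close>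

lemma q_vandermonde:
  assumes q: "norm q < 1"
  shows "(\<Sum>j\<le>n. q ^ (j * (j + c)) * (inv_qpoch q (int j) * inv_qpoch q (int n - int j) * inv_qpoch q (int (j + c)))) =
           inv_qpoch q (int n) * inv_qpoch q (int (n + c))"
proof -
  define v where "v = inv_qpoch q"
  define H where
    "H = (\<lambda>n c. \<Sum>j\<le>n. q ^ (j * (j + c)) * (v (int j) * v (int n - int j) * v (int (j + c))))"
  have rec: "v (int (Suc k)) * (1 - q ^ Suc k) = v (int k)" for k
    using inv_qpoch_rec[OF q, of "int (Suc k)"] unfolding power_int_of_nat v_def by simp
  have step: "(1 - q ^ Suc n) * H (Suc n) c = H n (Suc c)" for n c
  proof -
    \<comment> \<open>Uses 1 - q^(n+1) = q^j (1 - q^(n+1-j)) + (1 - q^j).\<close>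
    have split: "(1 - q ^ Suc n) * (v (int j) * v (int (Suc n) - int j)) =
        q ^ j * (v (int j) * v (int n - int j)) + v (int j - 1) * v (int (Suc n) - int j)"
      if "j \<le> Suc n" for j
    proof -
      have e: "int (Suc n - j) - 1 = int n - int j" "int (Suc n - j) = int (Suc n) - int j"
        using that by auto
      have B: "v (int n - int j) = v (int (Suc n) - int j) * (1 - q ^ (Suc n - j))"
        using inv_qpoch_rec[OF q, of "int (Suc n - j)"] e
        unfolding power_int_of_nat v_def by (simp only:)
      have A: "v (int j - 1) = v (int j) * (1 - q ^ j)"
        using inv_qpoch_rec[OF q, of "int j"] by (simp add: v_def)
      have X: "q ^ Suc n = q ^ j * q ^ (Suc n - j)"
        by (simp only: power_add [symmetric] le_add_diff_inverse that)
      show ?thesis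
        unfolding A B X by (simp add: algebra_simps del: power_Suc)
    qed
    have "(1 - q ^ Suc n) * H (Suc n) c =
        (\<Sum>j\<le>Suc n. q ^ (j * (j + c)) * v (int (j + c)) * (q ^ j * (v (int j) * v (int n - int j))))
      + (\<Sum>j\<le>Suc n. q ^ (j * (j + c)) * v (int (j + c)) * (v (int j - 1) * v (int (Suc n) - int j)))"
      unfolding H_def sum_distrib_left sum.distrib [symmetric]
    proof (intro sum.cong refl)
      fix j assume "j \<in> {..Suc n}"
      then have "j \<le> Suc n" by simp
      have "(1 - q ^ Suc n) * (q ^ (j * (j + c)) * (v (int j) * v (int (Suc n) - int j) * v (int (j + c))))
          = q ^ (j * (j + c)) * v (int (j + c)) * ((1 - q ^ Suc n) * (v (int j) * v (int (Suc n) - int j)))"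
        by (simp only: mult_ac)
      then show "(1 - q ^ Suc n) * (q ^ (j * (j + c)) * (v (int j) * v (int (Suc n) - int j) * v (int (j + c))))
          = q ^ (j * (j + c)) * v (int (j + c)) * (q ^ j * (v (int j) * v (int n - int j)))
          + q ^ (j * (j + c)) * v (int (j + c)) * (v (int j - 1) * v (int (Suc n) - int j))"
        unfolding split[OF \<open>j \<le> Suc n\<close>] by (simp only: ring_distribs)
    qed
    also have "(\<Sum>j\<le>Suc n. q ^ (j * (j + c)) * v (int (j + c)) * (q ^ j * (v (int j) * v (int n - int j))))
      = (\<Sum>j\<le>n. q ^ (j * (j + c)) * v (int (j + c)) * (q ^ j * (v (int j) * v (int n - int j))))"
      by (simp add: v_def)
    \<comment> \<open>The term j = 0 is zero because of \<open>v\<close> at -1, so the sum can be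
      shifted by one.\<close>
    also have "(\<Sum>j\<le>Suc n. q ^ (j * (j + c)) * v (int (j + c)) * (v (int j - 1) * v (int (Suc n) - int j)))
      = (\<Sum>j\<le>n. q ^ (Suc j * (Suc j + c)) * v (int (Suc j + c)) * (v (int j) * v (int n - int j)))"
      unfolding sum.atMost_Suc_shift by (simp add: v_def)
    \<comment> \<open>The two sums recombine termwise through v(j+c) + q^(j+c+1) v(j+c+1) =
      v(j+c+1), which is \<open>rec\<close>.\<close>
    also have "(\<Sum>j\<le>n. q ^ (j * (j + c)) * v (int (j + c)) * (q ^ j * (v (int j) * v (int n - int j)))) + \<dots> = H n (Suc c)"
      unfolding H_def sum.distrib [symmetric]
    proof (intro sum.cong refl)
      fix j
      have e: "j * (j + Suc c) = j * (j + c) + j" "Suc j * (Suc j + c) = j * (j + c) + j + Suc (j + c)"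
        by (simp_all add: algebra_simps)
      show "q ^ (j * (j + c)) * v (int (j + c)) * (q ^ j * (v (int j) * v (int n - int j))) +
          q ^ (Suc j * (Suc j + c)) * v (int (Suc j + c)) * (v (int j) * v (int n - int j)) =
          q ^ (j * (j + Suc c)) * (v (int j) * v (int n - int j) * v (int (j + Suc c)))"
        unfolding e power_add rec[of "j + c", symmetric] add_Suc_right add_Suc
        by (simp add: algebra_simps power_add)
    qed
    finally show ?thesis .
  qed
  have "H n c = v (int n) * v (int (n + c))" for n c
  proof (induction n arbitrary: c)
    case 0
    show ?case by (simp add: H_def v_def qpoch_def)
  next
    case (Suc n)
    have nz: "1 - q ^ Suc n \<noteq> 0"
      using qpoch_nonzero[OF q, of "Suc n"] by (simp add: qpoch_def)
    have "(1 - q ^ Suc n) * H (Suc n) c = (1 - q ^ Suc n) * (v (int (Suc n)) * v (int (Suc n + c)))"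
      unfolding step Suc.IH rec[of n, symmetric] by (simp only: mult_ac add_Suc add_Suc_right)
    with nz show ?case by (metis mult_cancel_left)
  qed
  then show ?thesis by (simp add: H_def v_def)
qed

text \<open>Bailey's lemma at a single index \<open>t\<close>. For t >= 0 put k = j + t: since k^2 =
  t^2 + j (j + 2t), this is \<open>q_vandermonde\<close> with n - t and c = 2t. The kernel is even
  in \<open>t\<close>, which settles t < 0.\<close>

lemma bailey_kernel_sum:
  fixes t :: int
  assumes q: "norm q < 1"
  shows "(\<Sum>k\<le>n. q ^ k\<^sup>2 * (inv_qpoch q (int n - int k) * (inv_qpoch q (int k - t) * inv_qpoch q (int k + t)))) =
           q powi t\<^sup>2 * (inv_qpoch q (int n - t) * inv_qpoch q (int n + t))"
proof -
  have *: "(\<Sum>k\<le>n. q ^ k\<^sup>2 * (inv_qpoch q (int n - int k) * (inv_qpoch q (int k - int r) * inv_qpoch q (int k + int r)))) =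
           q ^ r\<^sup>2 * (inv_qpoch q (int n - int r) * inv_qpoch q (int n + int r))" (is "?L = _") for r
  proof (cases "r \<le> n")
    case False
    then show ?thesis by (auto intro!: sum.neutral)
  next
    case True
    have "?L = (\<Sum>k\<in>{r..n}. q ^ k\<^sup>2 * (inv_qpoch q (int n - int k) * (inv_qpoch q (int k - int r) * inv_qpoch q (int k + int r))))"
      by (rule sum.mono_neutral_right) auto
    also have "\<dots> = (\<Sum>j\<le>n - r. q ^ r\<^sup>2 * (q ^ (j * (j + 2 * r)) * (inv_qpoch q (int j) * inv_qpoch q (int (n - r) - int j) * inv_qpoch q (int (j + 2 * r)))))"
    proof (rule sum.reindex_bij_witness[of _ "\<lambda>j. j + r" "\<lambda>k. k - r"], goal_cases)
      case (5 k)
      have e: "k\<^sup>2 = r\<^sup>2 + (k - r) * (k - r + 2 * r)"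
        using 5 by (auto simp: power2_eq_square algebra_simps dest!: le_Suc_ex)
      have "int (n - r) - int (k - r) = int n - int k" "int (k - r) = int k - int r"
        "int (k - r + 2 * r) = int k + int r"
        using 5 True by auto
      then show ?case unfolding e power_add by (simp only: mult_ac)
    qed (use True in auto)
    also have "\<dots> = q ^ r\<^sup>2 * (inv_qpoch q (int n - int r) * inv_qpoch q (int n + int r))"
      unfolding sum_distrib_left [symmetric] q_vandermonde[OF q]
      using True by (simp only: of_nat_diff of_nat_add) (simp add: algebra_simps)
    finally show ?thesis .
  qed
  show ?thesis
  proof (cases t rule: int_cases2)
    case (nonneg r)
    show ?thesis
      using *[of r] by (simp add: nonneg flip: of_nat_power)
  next
    case (nonpos r)
    then show ?thesis
      using *[of r] by (simp add: mult.commute[of "inv_qpoch q (_ + int r)"] flip: of_nat_power)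
  qed
qed


section \<open>Dominated convergence and summable majorants\<close>

text \<open>The majorant makes the finite partial sums converge uniformly in \<open>n\<close>
  (Weierstrass M-test), so the two limits may be exchanged.\<close>

lemma tendsto_infsum_dominated:
  fixes f :: "'a \<Rightarrow> nat \<Rightarrow> 'b :: banach"
  assumes lim: "\<And>x. (\<lambda>n. f x n) \<longlonglongrightarrow> g x"
    and bound: "\<And>x n. norm (f x n) \<le> M x"
    and M: "M summable_on UNIV"
  shows "(\<lambda>n. \<Sum>\<^sub>\<infinity>x. f x n) \<longlonglongrightarrow> (\<Sum>\<^sub>\<infinity>x. g x)"
proof (rule swap_uniform_limit')
  show "uniform_limit UNIV (\<lambda>X n. \<Sum>x\<in>X. f x n) (\<lambda>n. \<Sum>\<^sub>\<infinity>x. f x n) (finite_subsets_at_top UNIV)"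
    using bound M by (intro Weierstrass_m_test_general)
  show "\<forall>\<^sub>F X in finite_subsets_at_top UNIV. (\<lambda>n. \<Sum>x\<in>X. f x n) \<longlonglongrightarrow> (\<Sum>x\<in>X. g x)"
    by (intro always_eventually allI tendsto_sum lim)
  have "norm (g x) \<le> M x" for x
    using tendsto_norm[OF lim] by (rule Lim_bounded) (use bound in auto)
  then have "g summable_on UNIV"
    using Infinite_Sum.abs_summable_summable Infinite_Sum.abs_summable_on_comparison_test'[OF M, of g] by blast
  then show "((\<lambda>X. \<Sum>x\<in>X. g x) \<longlongrightarrow> (\<Sum>\<^sub>\<infinity>x. g x)) (finite_subsets_at_top UNIV)"
    using has_sum_infsum has_sum_def by blast
qed auto

lemma summable_on_times_nonneg:
  fixes f :: "'a \<Rightarrow> real" and g :: "'b \<Rightarrow> real"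
  assumes f: "f summable_on UNIV" "\<And>x. 0 \<le> f x" and g: "g summable_on UNIV" "\<And>y. 0 \<le> g y"
  shows "(\<lambda>(x, y). f x * g y) summable_on UNIV"
proof -
  have "(\<lambda>(x, y). f x * g y) summable_on UNIV \<times> UNIV"
  proof (rule summable_on_SigmaI)
    show "((\<lambda>y. case (x, y) of (x, y) \<Rightarrow> f x * g y) has_sum f x * infsum g UNIV) UNIV" for x
      using g(1) by (simp add: has_sum_cmult_right)
    show "(\<lambda>x. f x * infsum g UNIV) summable_on UNIV"
      using f(1) by (rule summable_on_cmult_left)
  qed (use f g in auto)
  then show ?thesis by simp
qed

lemma summable_on_power_nat:
  fixes r :: real
  assumes "0 \<le> r" "r < 1"
  shows "(\<lambda>n. r ^ n) summable_on (UNIV :: nat set)"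
  using assms by (simp add: summable_on_UNIV_nonneg_real_iff summable_geometric)

lemma summable_on_power_abs_int:
  fixes r :: real
  assumes "0 \<le> r" "r < 1"
  shows "(\<lambda>t. r ^ nat \<bar>t\<bar>) summable_on (UNIV :: int set)"
proof -
  have "(\<lambda>t. r ^ nat \<bar>t\<bar>) summable_on (range int)"
    using summable_on_power_nat[OF assms] by (subst summable_on_reindex) (auto simp: o_def)
  moreover have "(\<lambda>t. r ^ nat \<bar>t\<bar>) summable_on (range (\<lambda>n. - int n))"
    using summable_on_power_nat[OF assms] by (subst summable_on_reindex) (auto simp: o_def inj_on_def)
  moreover have "range int \<union> range (\<lambda>n. - int n) = UNIV"
    by (auto intro: int_cases2)
  ultimately show ?thesis using summable_on_union by metis
qed

lemma norm_power_square_le: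
  fixes q :: complex
  assumes "norm q < 1"
  shows "norm (q ^ n\<^sup>2) \<le> norm q ^ n"
  unfolding norm_power using assms by (intro power_decreasing) (auto simp: power2_eq_square)

lemma norm_powi_square_le:
  fixes q :: complex
  assumes "norm q < 1"
  shows "norm (q powi t\<^sup>2) \<le> norm q ^ nat \<bar>t\<bar>"
proof -
  have "t\<^sup>2 = int ((nat \<bar>t\<bar>)\<^sup>2)" by simp
  then have "q powi t\<^sup>2 = q ^ (nat \<bar>t\<bar>)\<^sup>2" by (metis power_int_of_nat)
  then show ?thesis using norm_power_square_le[OF assms] by simp
qed

section \<open>Bailey's lemma, iterated\<close>

text \<open>The limit of \<open>bailey_kernel_sum\<close> as \<open>n\<close> grows. The left side
  acquires one factor 1/(q;q)_inf and the right side two, so one of them cancels.\<close>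

lemma bailey_kernel_has_sum:
  fixes t :: int
  assumes q: "norm q < 1"
  shows "((\<lambda>k. q ^ k\<^sup>2 * (inv_qpoch q (int k - t) * inv_qpoch q (int k + t))) has_sum
           q powi t\<^sup>2 / qpoch_inf q q) UNIV"
proof -
  define v where "v = inv_qpoch q"
  define w where "w = (\<lambda>k. q ^ k\<^sup>2 * (v (int k - t) * v (int k + t)))"
  define P where "P = qpoch_inf q q"
  have P: "P \<noteq> 0" using qpoch_inf_nonzero[OF q] by (simp add: P_def)
  obtain C where C: "C > 0" "\<And>k. norm (v k) \<le> C"
    using inv_qpoch_bounded[OF q] unfolding v_def by blast
  have w_le: "norm (w k) \<le> C * C * norm q ^ k" for k
  proof -
    have "norm (w k) \<le> norm q ^ k * (C * C)"
      unfolding w_def norm_mult using C norm_power_square_le[OF q, of k]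
      by (intro mult_mono) (auto intro: less_imp_le)
    then show ?thesis by (simp add: mult_ac)
  qed
  have M: "(\<lambda>k. c * norm q ^ k) summable_on (UNIV :: nat set)" for c
    using q by (intro summable_on_cmult_right summable_on_power_nat) auto
  have "(\<lambda>n. \<Sum>\<^sub>\<infinity>k. v (int n - int k) * w k) \<longlonglongrightarrow> (\<Sum>\<^sub>\<infinity>k. inverse P * w k)"
  proof (rule tendsto_infsum_dominated[OF _ _ M])
    show "(\<lambda>n. v (int n - int k) * w k) \<longlonglongrightarrow> inverse P * w k" for k
      using inv_qpoch_tendsto[OF q, of "- int k"] unfolding v_def P_def
      by (intro tendsto_mult_right) simp
    show "norm (v (int n - int k) * w k) \<le> (C * (C * C)) * norm q ^ k" for k n
      unfolding norm_mult using mult_mono[OF C(2)[of "int n - int k"] w_le[of k]] C(1)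
      by (simp add: mult_ac)
  qed
  moreover have "(\<Sum>\<^sub>\<infinity>k. v (int n - int k) * w k) = q powi t\<^sup>2 * (v (int n - t) * v (int n + t))" for n
  proof -
    \<comment> \<open>For k > n the factor \<open>v (int n - int k)\<close> is zero, so the full
      series is the finite sum.\<close>
    have "((\<lambda>k. v (int n - int k) * w k) has_sum (\<Sum>k\<le>n. v (int n - int k) * w k)) UNIV"
      by (rule has_sum_finite_neutralI[of "{..n}"]) (auto simp: v_def)
    then show ?thesis
      using bailey_kernel_sum[OF q, of n t] by (simp add: w_def v_def mult_ac infsumI)
  qed
  moreover have "(\<lambda>n. q powi t\<^sup>2 * (v (int n - t) * v (int n + t))) \<longlonglongrightarrow> q powi t\<^sup>2 * (inverse P * inverse P)"
    using inv_qpoch_tendsto[OF q, of "- t"] inv_qpoch_tendsto[OF q, of t] unfolding v_def P_def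
    by (intro tendsto_intros) simp_all
  ultimately have "(\<Sum>\<^sub>\<infinity>k. inverse P * w k) = q powi t\<^sup>2 * (inverse P * inverse P)"
    using LIMSEQ_unique by simp
  then have "inverse P * infsum w UNIV = q powi t\<^sup>2 * (inverse P * inverse P)"
    by (simp only: infsum_cmult_right')
  then have "infsum w UNIV = q powi t\<^sup>2 / P"
    using P by (simp add: field_simps)
  moreover have "w summable_on UNIV"
    using Infinite_Sum.abs_summable_summable Infinite_Sum.abs_summable_on_comparison_test'[OF M w_le] by blast
  ultimately have "(w has_sum q powi t\<^sup>2 / P) UNIV"
    using has_sum_infsum[of w UNIV] by simp
  then show ?thesis
    unfolding w_def v_def P_def .
qed

text \<open>With n = m + k and \<open>\<beta>\<close> expanded, the left side is an absolutely
  convergent sum over (n, k, t). Summing it with \<open>t\<close> outermost, first over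
  \<open>k\<close> and then over \<open>n\<close>, yields one factor \<open>q powi t\<^sup>2\<close>
  each time.\<close>

lemma bailey_lemma_twice:
  fixes q :: complex and \<alpha> :: "int \<Rightarrow> complex"
  assumes q: "norm q < 1"
    and \<alpha>: "(\<lambda>t. norm (\<alpha> t)) summable_on UNIV"
    and \<beta>: "\<And>n. \<beta> n = (\<Sum>t = -int n..int n. \<alpha> t * (inv_qpoch q (int n - t) * inv_qpoch q (int n + t)))"
  shows "((\<lambda>(m, k). q ^ (k\<^sup>2 + (m + k)\<^sup>2) * (inv_qpoch q (int m) * \<beta> k)) has_sum
           (\<Sum>\<^sub>\<infinity>t. \<alpha> t * (q powi t\<^sup>2)\<^sup>2) / qpoch_inf q q) UNIV"
proof -
  define v where "v = inv_qpoch q"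
  define F where "F = (\<lambda>((n, k), t). (q ^ n\<^sup>2 * (q ^ k\<^sup>2 * v (int n - int k))) * (\<alpha> t * (v (int k - t) * v (int k + t))))"
  define S where "S = infsum F UNIV"
  obtain C where C: "C > 0" "\<And>k. norm (v k) \<le> C"
    using inv_qpoch_bounded[OF q] unfolding v_def by blast
  define G where "G = (\<lambda>(n, k). q ^ n\<^sup>2 * (q ^ k\<^sup>2 * (v (int n - int k) * \<beta> k)))"
  define r where "r = norm q"
  have r: "0 \<le> r" "r < 1" using q by (auto simp: r_def)
  \<comment> \<open>Three bounded \<open>inv_qpoch\<close> factors give C^3; the squares in the
    exponents are relaxed to r^n r^k, and \<open>\<alpha>\<close> is summable by hypothesis.\<close>
  have F: "F summable_on UNIV"
  proof (rule Infinite_Sum.abs_summable_summable, rule Infinite_Sum.abs_summable_on_comparison_test')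
    show "(\<lambda>x. (C * (C * C)) * (case x of (nk, t) \<Rightarrow> (case nk of (n, k) \<Rightarrow> r ^ n * r ^ k) * norm (\<alpha> t))) summable_on UNIV"
      using r \<alpha>
      by (intro summable_on_cmult_right summable_on_times_nonneg summable_on_power_nat) auto
    fix x :: "(nat \<times> nat) \<times> int"
    obtain n k t where x: "x = ((n, k), t)" by (metis prod.exhaust)
    have "norm (F x) \<le> (r ^ n * (r ^ k * C)) * (norm (\<alpha> t) * (C * C))"
      unfolding F_def x prod.case norm_mult using C norm_power_square_le[OF q] r
      by (intro mult_mono) (auto simp: r_def intro: less_imp_le)
    then show "norm (F x) \<le> (C * (C * C)) * (case x of (nk, t) \<Rightarrow> (case nk of (n, k) \<Rightarrow> r ^ n * r ^ k) * norm (\<alpha> t))"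
      by (simp add: x mult_ac)
  qed
  then have FS: "(F has_sum S) (UNIV \<times> UNIV)"
    by (simp add: S_def)
  \<comment> \<open>First order of summation: \<open>t\<close> innermost restores
    \<open>\<beta>\<close>, as the terms with |t| > k are zero. Only pairs with k <= n then
    contribute, and (m, k) -> (m + k, k) parametrizes them.\<close>
  have "(G has_sum S) UNIV"
  proof (rule has_sum_SigmaD[OF FS])
    fix x :: "nat \<times> nat"
    obtain n k where x: "x = (n, k)" by (metis prod.exhaust)
    show "((\<lambda>t. F (x, t)) has_sum G x) UNIV"
      by (rule has_sum_finite_neutralI[of "{-int k..int k}"])
         (auto simp: F_def G_def x v_def \<beta> sum_distrib_left mult_ac)
  qed
  also have "(G has_sum S) UNIV \<longleftrightarrow> (G has_sum S) {(n, k). k \<le> n}"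
    by (rule has_sum_cong_neutral) (auto simp: G_def v_def)
  also have "\<dots> \<longleftrightarrow> ((\<lambda>(m, k). q ^ (k\<^sup>2 + (m + k)\<^sup>2) * (v (int m) * \<beta> k)) has_sum S) UNIV"
    by (rule has_sum_reindex_bij_witness[of _ "\<lambda>(m, k). (m + k, k)" "\<lambda>(n, k). (n - k, k)"])
       (auto simp: G_def power_add of_nat_diff mult_ac)
  finally have main: "((\<lambda>(m, k). q ^ (k\<^sup>2 + (m + k)\<^sup>2) * (v (int m) * \<beta> k)) has_sum S) UNIV" .
  have swapped: "((\<lambda>(t, nk). F (nk, t)) has_sum S) (UNIV \<times> UNIV)"
    using FS by (subst (asm) has_sum_swap)
  \<comment> \<open>Second order of summation: the finite kernel sum handles \<open>k\<close>, the
    infinite one handles \<open>n\<close>.\<close>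
  have "((\<lambda>t. \<alpha> t * (q powi t\<^sup>2)\<^sup>2 / qpoch_inf q q) has_sum S) UNIV"
  proof (rule has_sum_SigmaD[OF swapped])
    fix t :: int
    have "(\<lambda>(t, nk). F (nk, t)) summable_on UNIV \<times> UNIV"
      using swapped by (auto simp: summable_on_def)
    then have summ: "(\<lambda>nk. F (nk, t)) summable_on UNIV \<times> UNIV"
      using summable_on_SigmaD1[of "\<lambda>t nk. F (nk, t)" UNIV "\<lambda>_. UNIV" t] by simp
    have "((\<lambda>nk. F (nk, t)) has_sum \<alpha> t * (q powi t\<^sup>2)\<^sup>2 / qpoch_inf q q) (UNIV \<times> UNIV)"
    proof (rule has_sum_SigmaI[OF _ _ summ])
      show "((\<lambda>k. F ((n, k), t)) has_sum
              \<alpha> t * q powi t\<^sup>2 * (q ^ n\<^sup>2 * (v (int n - t) * v (int n + t)))) UNIV" for n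
      proof (rule has_sum_finite_neutralI[of "{..n}"])
        have "(\<Sum>k\<le>n. F ((n, k), t)) = \<alpha> t * q ^ n\<^sup>2 * (\<Sum>k\<le>n. q ^ k\<^sup>2 * (v (int n - int k) * (v (int k - t) * v (int k + t))))"
          unfolding sum_distrib_left F_def prod.case by (intro sum.cong) (simp_all only: mult_ac)
        then show "\<alpha> t * q powi t\<^sup>2 * (q ^ n\<^sup>2 * (v (int n - t) * v (int n + t))) = (\<Sum>k\<le>n. F ((n, k), t))"
          using bailey_kernel_sum[OF q, of n t] by (simp add: v_def mult_ac)
      qed (auto simp: F_def v_def)
      show "((\<lambda>n. \<alpha> t * q powi t\<^sup>2 * (q ^ n\<^sup>2 * (v (int n - t) * v (int n + t)))) has_sum
              \<alpha> t * (q powi t\<^sup>2)\<^sup>2 / qpoch_inf q q) UNIV"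
        using has_sum_cmult_right[OF bailey_kernel_has_sum[OF q, of t], of "\<alpha> t * q powi t\<^sup>2"]
        by (simp add: v_def power2_eq_square mult_ac)
    qed
    then show "((\<lambda>nk. case (t, nk) of (t, nk) \<Rightarrow> F (nk, t)) has_sum \<alpha> t * (q powi t\<^sup>2)\<^sup>2 / qpoch_inf q q) UNIV"
      by simp
  qed
  then have "S = (\<Sum>\<^sub>\<infinity>t. \<alpha> t * (q powi t\<^sup>2)\<^sup>2 / qpoch_inf q q)"
    by (simp add: infsumI)
  also have "\<dots> = (\<Sum>\<^sub>\<infinity>t. \<alpha> t * (q powi t\<^sup>2)\<^sup>2) / qpoch_inf q q"
    unfolding divide_inverse by (rule infsum_cmult_left')
  finally show ?thesis
    using main by (simp add: v_def)
qed

section \<open>The triple product at x = i, finite and infinite\<close>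

text \<open>At x = i the factors pair up as (1 + iz)(1 + z/i) = 1 + z^2. Divided by the first factor
  on the right, this is the Bailey pair with q = y^2.\<close>

lemma finite_jacobi_triple_imaginary:
  fixes y :: complex
  assumes y: "norm y < 1" "y \<noteq> 0"
  shows "qpoch (- (y\<^sup>2)) (y ^ 4) n =
           qpoch (y\<^sup>2) (y\<^sup>2) (2 * n) * (\<Sum>t = -int n..int n. \<i> powi t * y powi t\<^sup>2 *
             (inv_qpoch (y\<^sup>2) (int n - t) * inv_qpoch (y\<^sup>2) (int n + t)))"
proof -
  have "(1 + \<i> * y ^ (2 * j + 1)) * (1 + y ^ (2 * j + 1) / \<i>) = 1 - (- (y\<^sup>2)) * (y ^ 4) ^ j" for j
  proof -
    have "(1 + \<i> * z) * (1 + z / \<i>) = 1 + z\<^sup>2" for z :: complex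
      by (simp add: field_simps power2_eq_square)
    moreover have "(y ^ (2 * j + 1))\<^sup>2 = y\<^sup>2 * (y ^ 4) ^ j"
      unfolding power_mult [symmetric] power_add [symmetric]
      by (rule arg_cong[where f = "power y"]) simp
    ultimately show ?thesis by simp
  qed
  then have "qpoch (- (y\<^sup>2)) (y ^ 4) n =
      (\<Prod>j<n. 1 + \<i> * y ^ (2 * j + 1)) * (\<Prod>j<n. 1 + y ^ (2 * j + 1) / \<i>)"
    by (simp add: qpoch_def prod.distrib [symmetric])
  then show ?thesis
    using finite_jacobi_triple[OF y, of \<i> n n] by (simp add: mult_2)
qed

text \<open>Let n grow in the finite identity divided by (y^2;y^2)_(2n). The kernel tends to 1/P^2
  and the left side to (-y^2;y^4)_inf / P, which leaves one factor \<open>P\<close>.\<close>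

lemma infinite_jacobi_triple_imaginary:
  fixes y :: complex
  assumes y: "norm y < 1" "y \<noteq> 0"
  shows "(\<Sum>\<^sub>\<infinity>t. \<i> powi t * y powi t\<^sup>2) = qpoch_inf (y\<^sup>2) (y\<^sup>2) * qpoch_inf (- (y\<^sup>2)) (y ^ 4)"
proof -
  define v where "v = inv_qpoch (y\<^sup>2)"
  define P where "P = qpoch_inf (y\<^sup>2) (y\<^sup>2)"
  define a where "a = (\<lambda>t. \<i> powi t * y powi t\<^sup>2)"
  have y2: "norm (y\<^sup>2) < 1" and y4: "norm (y ^ 4) < 1"
    using y by (auto simp: norm_power power_less_one_iff abs_square_less_1)
  have P: "P \<noteq> 0" using qpoch_inf_nonzero[OF y2] by (simp add: P_def)
  obtain C where C: "C > 0" "\<And>k. norm (v k) \<le> C"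
    using inv_qpoch_bounded[OF y2] unfolding v_def by blast
  have "(\<lambda>n. \<Sum>\<^sub>\<infinity>t. a t * (v (int n - t) * v (int n + t))) \<longlonglongrightarrow> (\<Sum>\<^sub>\<infinity>t. a t * (inverse P * inverse P))"
  proof (rule tendsto_infsum_dominated)
    show "(\<lambda>n. a t * (v (int n - t) * v (int n + t))) \<longlonglongrightarrow> a t * (inverse P * inverse P)" for t
      using inv_qpoch_tendsto[OF y2, of "- t"] inv_qpoch_tendsto[OF y2, of t] unfolding v_def P_def
      by (intro tendsto_intros) simp_all
    show "norm (a t * (v (int n - t) * v (int n + t))) \<le> norm y ^ nat \<bar>t\<bar> * (C * C)" for t n
      unfolding a_def norm_mult using C norm_powi_square_le[OF y(1), of t]
      by (intro mult_mono) (auto simp: norm_power_int intro: less_imp_le)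
    show "(\<lambda>t. norm y ^ nat \<bar>t\<bar> * (C * C)) summable_on UNIV"
      using y by (intro summable_on_cmult_left summable_on_power_abs_int) auto
  qed
  moreover have "(\<Sum>\<^sub>\<infinity>t. a t * (v (int n - t) * v (int n + t))) =
      qpoch (- (y\<^sup>2)) (y ^ 4) n / qpoch (y\<^sup>2) (y\<^sup>2) (2 * n)" for n
  proof -
    have "((\<lambda>t. a t * (v (int n - t) * v (int n + t))) has_sum
        (\<Sum>t = -int n..int n. a t * (v (int n - t) * v (int n + t)))) UNIV"
      by (rule has_sum_finite_neutralI[of "{-int n..int n}"]) (auto simp: v_def)
    then show ?thesis
      using finite_jacobi_triple_imaginary[OF y, of n] qpoch_nonzero[OF y2]
      by (simp add: a_def v_def infsumI)
  qed
  moreover have "(\<lambda>n. qpoch (- (y\<^sup>2)) (y ^ 4) n / qpoch (y\<^sup>2) (y\<^sup>2) (2 * n)) \<longlonglongrightarrow> qpoch_inf (- (y\<^sup>2)) (y ^ 4) / P"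
  proof -
    have "filterlim (\<lambda>n::nat. 2 * n) sequentially sequentially"
      by (rule filterlim_subseq) (simp add: strict_mono_def)
    then have "(\<lambda>n. qpoch (y\<^sup>2) (y\<^sup>2) (2 * n)) \<longlonglongrightarrow> P"
      unfolding P_def by (rule filterlim_compose[OF qpoch_tendsto[OF y2]])
    then show ?thesis
      using P by (intro tendsto_divide qpoch_tendsto y4)
  qed
  ultimately have "(\<Sum>\<^sub>\<infinity>t. a t * (inverse P * inverse P)) = qpoch_inf (- (y\<^sup>2)) (y ^ 4) / P"
    using LIMSEQ_unique by simp
  then have "(\<Sum>\<^sub>\<infinity>t. a t) * (inverse P * inverse P) = qpoch_inf (- (y\<^sup>2)) (y ^ 4) / P"
    by (simp only: infsum_cmult_left')
  then show ?thesis
    using P by (simp add: a_def P_def field_simps)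
qed

section \<open>Rearranging infinite products\<close>

lemma qpoch_inf_even_odd:
  fixes q :: complex
  assumes "norm q < 1"
  shows "qpoch_inf q q = qpoch_inf q (q\<^sup>2) * qpoch_inf (q\<^sup>2) (q\<^sup>2)"
proof -
  have q2: "norm (q\<^sup>2) < 1"
    using assms by (simp add: norm_power abs_square_less_1)
  have "qpoch q q (2 * n) = qpoch q (q\<^sup>2) n * qpoch (q\<^sup>2) (q\<^sup>2) n" for n
    by (induction n; simp add: qpoch_def mult_2 power2_eq_square power_mult_distrib power_add;
        simp add: mult_ac)
  moreover have "filterlim (\<lambda>n::nat. 2 * n) sequentially sequentially"
    by (rule filterlim_subseq) (simp add: strict_mono_def)
  then have "(\<lambda>n. qpoch q q (2 * n)) \<longlonglongrightarrow> qpoch_inf q q"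
    by (rule filterlim_compose[OF qpoch_tendsto[OF assms]])
  ultimately show ?thesis
    using LIMSEQ_unique[OF _ tendsto_mult[OF qpoch_tendsto[OF q2, of q] qpoch_tendsto[OF q2, of "q\<^sup>2"]]]
    by simp
qed

lemma qpoch_inf_times_minus:
  fixes a q :: complex
  assumes "norm q < 1"
  shows "qpoch_inf a q * qpoch_inf (- a) q = qpoch_inf (a\<^sup>2) (q\<^sup>2)"
proof -
  have q2: "norm (q\<^sup>2) < 1"
    using assms by (simp add: norm_power abs_square_less_1)
  have "qpoch a q n * qpoch (- a) q n = qpoch (a\<^sup>2) (q\<^sup>2) n" for n
    unfolding qpoch_def prod.distrib [symmetric]
    by (rule prod.cong) (simp_all add: algebra_simps power2_eq_square power_mult_distrib)
  then show ?thesis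
    using LIMSEQ_unique[OF tendsto_mult[OF qpoch_tendsto[OF assms, of a] qpoch_tendsto[OF assms, of "- a"]]]
      qpoch_tendsto[OF q2] by simp
qed

section \<open>Assembling the identity\<close>

theorem mainTheorem10:
  fixes q :: complex
  assumes "norm q < 1"
  shows "((\<lambda>(m, k). q ^ (k\<^sup>2 + (m + k)\<^sup>2) / (qpoch q q m * qpoch q q (2 * k)) * qpoch (- q) (q\<^sup>2) k)
           has_sum
           (qpoch_inf_list [q ^ 20, q ^ 10, q ^ 10] (q ^ 20) / qpoch_inf q q))
         (UNIV :: (nat \<times> nat) set)"
proof (cases "q = 0")
  \<comment> \<open>The triple product needs a nonzero base. At q = 0 only the term m = k = 0
    survives, with 0^0 = 1.\<close>
  case True
  have "qpoch 0 0 n = 1" "qpoch_inf 0 0 = 1" for n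
    by (simp_all add: qpoch_def qpoch_inf_def)
  then show ?thesis
    unfolding True
    by (intro has_sum_finite_neutralI[of "{(0, 0)}"])
       (auto simp: qpoch_inf_list_def qpoch_def)
next
  case False
  \<comment> \<open>The Bailey pair carries q^(t^2/2), hence the square root.\<close>
  define y where "y = csqrt q"
  have y2: "y\<^sup>2 = q"
    by (simp add: y_def)
  then have y4: "y ^ 4 = q\<^sup>2"
    by (auto simp flip: power_mult)
  have y: "norm y < 1" "y \<noteq> 0"
    using assms False by (auto simp: y_def norm_csqrt)
  define \<alpha> where "\<alpha> = (\<lambda>t. \<i> powi t * y powi t\<^sup>2)"
  define \<beta> where "\<beta> = (\<lambda>k. qpoch (- q) (q\<^sup>2) k / qpoch q q (2 * k))"
  have \<beta>: "\<beta> n = (\<Sum>t = -int n..int n. \<alpha> t * (inv_qpoch q (int n - t) * inv_qpoch q (int n + t)))" for n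
    using finite_jacobi_triple_imaginary[OF y, of n] qpoch_nonzero[OF assms]
    by (simp add: \<beta>_def \<alpha>_def y2 y4)
  have \<alpha>: "(\<lambda>t. norm (\<alpha> t)) summable_on UNIV"
  proof (rule Infinite_Sum.abs_summable_on_comparison_test'[OF summable_on_power_abs_int])
    show "norm (\<alpha> t) \<le> norm y ^ nat \<bar>t\<bar>" for t
      using norm_powi_square_le[OF y(1)] by (simp add: \<alpha>_def norm_mult norm_power_int)
  qed (use y in auto)
  \<comment> \<open>The exponents of \<open>y\<close> add up to t^2 + 4 t^2 = 5 t^2; this is the
    origin of the powers q^5, q^10 and q^20.\<close>
  have "\<alpha> t * (q powi t\<^sup>2)\<^sup>2 = \<i> powi t * (y ^ 5) powi t\<^sup>2" for t
  proof -
    have "(y ^ b) powi t\<^sup>2 = (y powi t\<^sup>2) ^ b" for b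
      by (simp add: power_int_power power_int_power' mult.commute)
    then show ?thesis
      by (simp add: \<alpha>_def flip: y2 power_mult power_Suc)
  qed
  then have "(\<Sum>\<^sub>\<infinity>t. \<alpha> t * (q powi t\<^sup>2)\<^sup>2) = (\<Sum>\<^sub>\<infinity>t. \<i> powi t * (y ^ 5) powi t\<^sup>2)"
    by simp
  also have "\<dots> = qpoch_inf (q ^ 5) (q ^ 5) * qpoch_inf (- (q ^ 5)) ((q ^ 5)\<^sup>2)"
  proof -
    have "norm (y ^ 5) < 1" using y by (simp add: norm_power power_less_one_iff)
    moreover have "(y ^ 5)\<^sup>2 = q ^ 5" "(y ^ 5) ^ 4 = (q ^ 5)\<^sup>2"
      by (simp_all flip: y2 power_mult)
    ultimately show ?thesis
      using infinite_jacobi_triple_imaginary[of "y ^ 5"] y by simp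
  qed
  also have "\<dots> = qpoch_inf_list [q ^ 20, q ^ 10, q ^ 10] (q ^ 20)"
  proof -
    \<comment> \<open>With z = q^5: (z;z) = (z;z^2)(z^2;z^2), then (z;z^2)(-z;z^2) = (z^2;z^4) and
      (z^2;z^2) = (z^2;z^4)(z^4;z^4), all products infinite.\<close>
    have n: "norm (q ^ 5) < 1" "norm (q ^ 10) < 1"
      using assms by (simp_all add: norm_power power_less_one_iff)
    show ?thesis
      using qpoch_inf_even_odd[OF n(1)] qpoch_inf_even_odd[OF n(2)]
        qpoch_inf_times_minus[of "q ^ 10" "q ^ 5"] n
      by (simp add: qpoch_inf_list_def mult_ac flip: power_mult)
  qed
  finally have "(\<Sum>\<^sub>\<infinity>t. \<alpha> t * (q powi t\<^sup>2)\<^sup>2) = qpoch_inf_list [q ^ 20, q ^ 10, q ^ 10] (q ^ 20)" .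
  moreover have "(\<lambda>(m, k). q ^ (k\<^sup>2 + (m + k)\<^sup>2) / (qpoch q q m * qpoch q q (2 * k)) * qpoch (- q) (q\<^sup>2) k)
      = (\<lambda>(m, k). q ^ (k\<^sup>2 + (m + k)\<^sup>2) * (inv_qpoch q (int m) * \<beta> k))"
    by (auto simp: \<beta>_def field_simps)
  ultimately show ?thesis
    using bailey_lemma_twice[OF assms \<alpha> \<beta>] by simp
qed

end
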